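(* Let $\theta\in[1/2,1]$ and suppose the adjacent time-step ratios satisfy $0<r_k\le r_s$ for all $k\ge2$, where $r_s=r_s(\theta)$. Then the solution $u^n$ of the WSBDF2 scheme satisfies the discrete energy dissipation law $$\partial_\tau E^k\le 2\bigl(\theta f^k+(1-\theta)f^{k-1},\,\partial_\tau u^k\bigr)\qquad\text{for } 1\le k\le N .$$ Consequently the discrete solution is unconditionally stable in the energy norm: $$\sqrt{E^n}\le\sqrt{E^0}+4C_\Omega\Bigl(\|f^0\|+\sum_{k=1}^n\|\nabla_\tau f^k\|\Bigr)\qquad\text{for } 1\le n\le N .$$
   Context: Let $\Omega$ be a bounded domain, $(\cdot,\cdot)$ and $\|\cdot\|$ the inner product and norm of $L^2(\Omega)$, and $C_\Omega>0$ a Poincaré constant: $\|\phi\|\le C_\Omega\|\nabla\phi\|$ for all $\phi\in H_0^1(\Omega)$. Let $0=t_0<t_1<\cdots<t_N=T$ be a nonuniform time grid with steps $\tau_k=t_k-t_{k-1}>0$ ($1\le k\le N$) and ratios $r_k=\tau_k/\tau_{k-1}$ ($2\le k\le N$); $r_{N+1}$, which appears only in $E^N$, denotes any fixed number in $(0,r_s]$ (finite). For a sequence $\{v^n\}$ write $\nabla_\tau v^n=v^n-v^{n-1}$ and $\partial_\tau v^n=\nabla_\tau v^n/\tau_n$. The WSBDF2 operator is $D_2v^1=\nabla_\tau v^1/\tau_1$ and $$D_2v^n=\frac{1+2\theta r_n}{\tau_n(1+r_n)}\nabla_\tau v^n+\frac{(1-2\theta)r_n^2}{\tau_n(1+r_n)}\nabla_\tau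 v^{n-1},\qquad n\ge2 .$$ Given $u^0\in H_0^1(\Omega)$ and $f^n=f(t_n)\in L^2(\Omega)$ ($0\le n\le N$), the WSBDF2 scheme for $u_t-\Delta u=f$ with homogeneous Dirichlet boundary conditions defines $u^1,\dots,u^N\in H_0^1(\Omega)$ by $D_2u^n-\theta\Delta u^n-(1-\theta)\Delta u^{n-1}=\theta f^n+(1-\theta)f^{n-1}$, $1\le n\le N$, understood in the weak form $$(D_2u^n,\phi)+\bigl(\theta\nabla u^n+(1-\theta)\nabla u^{n-1},\nabla\phi\bigr)=\bigl(\theta f^n+(1-\theta)f^{n-1},\phi\bigr)\quad\forall\phi\in H_0^1(\Omega).$$ The (modified) discrete energy is $$E^k=\frac{(2\theta-1)r_{k+1}^{3/2}}{1+r_{k+1}}\,\tau_k\|\partial_\tau u^k\|^2+\|\nabla u^k\|^2\quad(k\ge1),\qquad E^0=\|\nabla u^0\|^2 .$$ For $\theta\in(1/2,1]$, $$r_s=\frac{4\theta^2-\sqrt[3]{-4\theta^2E+3(1-2\theta)^2\frac{-F+\sqrt G}{2}}-\sqrt[3]{-4\theta^2E+3(1-2\theta)^2\frac{-F-\sqrt G}{2}}}{3(1-2\theta)^2},$$ where, in this formula only, $E=16\theta^4+48\theta^3-48\theta^2+12\theta$, $F=16\theta^3+36\theta^2-36\theta+9$, $G=384\theta^5+912\theta^4-2496\theta^3+1944\theta^2-648\theta+81$ (real cube roots); equivalently, $r_s$ is the positive root of $(1-2\theta)^2r^3-4\theta^2r^2-4\theta r-1=0$. For $\theta=1/2$, $r_s=\infty$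 (no upper restriction on the ratios). *)

theory Defs
  imports "HOL-Analysis.Analysis"
begin

section \<open>The space $L^2$\<close>

text \<open>Elements of \<open>L\<^sup>2\<close> are represented by functions, not by classes modulo null sets.
  The codomain is \<open>real\<close> for scalar functions and the ambient space for gradients.\<close>

definition L2 :: "'a::euclidean_space set \<Rightarrow> ('a \<Rightarrow> 'b::euclidean_space) set" where
  "L2 \<Omega> = {f. f \<in> borel_measurable (lebesgue_on \<Omega>) \<and>
               integrable (lebesgue_on \<Omega>) (\<lambda>x. (norm (f x))\<^sup>2)}"

definition L2_inner ::
    "'a::euclidean_space set \<Rightarrow> ('a \<Rightarrow> 'b::euclidean_space) \<Rightarrow> ('a \<Rightarrow> 'b) \<Rightarrow> real" where
  "L2_inner \<Omega> f g = (LINT x|lebesgue_on \<Omega>. f x \<bullet> g x)"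

definition L2_norm :: "'a::euclidean_space set \<Rightarrow> ('a \<Rightarrow> 'b::euclidean_space) \<Rightarrow> real" where
  "L2_norm \<Omega> f = sqrt (L2_inner \<Omega> f f)"


section \<open>Weak gradients and the space $H_0^1$\<close>

text \<open>\<open>Ck k \<phi>\<close>: \<open>\<phi>\<close> is \<open>k\<close> times continuously differentiable on the whole space
  (all partial derivatives of a differentiable \<open>\<phi>\<close> are \<open>k - 1\<close> times continuously
  differentiable; continuity of \<open>\<phi>\<close> itself follows from differentiability).\<close>

primrec Ck :: "nat \<Rightarrow> ('a::euclidean_space \<Rightarrow> real) \<Rightarrow> bool" where
  "Ck 0 \<phi> \<longleftrightarrow> continuous_on UNIV \<phi>"
| "Ck (Suc k) \<phi> \<longleftrightarrow>
     (\<exists>D\<phi>. (\<forall>x. GDERIV \<phi> x :> D\<phi> x) \<and> (\<forall>i\<in>Basis. Ck k (\<lambda>x. D\<phi> x \<bullet> i)))"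

text \<open>The functions in \<open>C\<^sub>c\<^sup>\<infinity>(\<Omega>)\<close>, extended by zero to the whole space.\<close>

definition test_fun :: "'a::euclidean_space set \<Rightarrow> ('a \<Rightarrow> real) \<Rightarrow> bool" where
  "test_fun \<Omega> \<phi> \<longleftrightarrow> (\<forall>k. Ck k \<phi>) \<and>
     compact (closure {x. \<phi> x \<noteq> 0}) \<and> closure {x. \<phi> x \<noteq> 0} \<subseteq> \<Omega>"

text \<open>A weak gradient is unique only up to a null set, so it is a relation between \<open>u\<close> and a
  representative \<open>g\<close> of its gradient. \<open>has_weak_gradient \<Omega> u g\<close> for some \<open>g\<close> says that \<open>u\<close> is
  in \<open>H\<^sup>1(\<Omega>)\<close>.\<close>

definition has_weak_gradient ::
    "'a::euclidean_space set \<Rightarrow> ('a \<Rightarrow> real) \<Rightarrow> ('a \<Rightarrow> 'a) \<Rightarrow> bool" where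
  "has_weak_gradient \<Omega> u g \<longleftrightarrow> u \<in> L2 \<Omega> \<and> g \<in> L2 \<Omega> \<and>
     (\<forall>\<phi> D\<phi>. test_fun \<Omega> \<phi> \<longrightarrow> (\<forall>x. GDERIV \<phi> x :> D\<phi> x) \<longrightarrow>
        (LINT x|lebesgue_on \<Omega>. u x *\<^sub>R D\<phi> x) = - (LINT x|lebesgue_on \<Omega>. \<phi> x *\<^sub>R g x))"

text \<open>\<open>H\<^sub>0\<^sup>1(\<Omega>)\<close> is the closure of \<open>C\<^sub>c\<^sup>\<infinity>(\<Omega>)\<close> in \<open>H\<^sup>1(\<Omega>)\<close>.\<close>

definition H01 :: "'a::euclidean_space set \<Rightarrow> ('a \<Rightarrow> real) set" where
  "H01 \<Omega> = {u. \<exists>g. has_weak_gradient \<Omega> u g \<and>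
     (\<exists>\<phi> D\<phi>. (\<forall>j. test_fun \<Omega> (\<phi> j) \<and> (\<forall>x. GDERIV (\<phi> j) x :> D\<phi> j x)) \<and>
        (\<lambda>j::nat. L2_norm \<Omega> (\<lambda>x. u x - \<phi> j x)) \<longlonglongrightarrow> 0 \<and>
        (\<lambda>j::nat. L2_norm \<Omega> (\<lambda>x. g x - D\<phi> j x)) \<longlonglongrightarrow> 0)}"

definition poincare_constant :: "'a::euclidean_space set \<Rightarrow> real \<Rightarrow> bool" where
  "poincare_constant \<Omega> C \<longleftrightarrow> C > 0 \<and>
     (\<forall>\<phi> D\<phi>. \<phi> \<in> H01 \<Omega> \<longrightarrow> has_weak_gradient \<Omega> \<phi> D\<phi> \<longrightarrow> L2_norm \<Omega> \<phi> \<le> C * L2_norm \<Omega> D\<phi>)"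


section \<open>Difference operators on a nonuniform time grid\<close>

text \<open>These operators act on real sequences; to a sequence of functions \<open>u\<close> they are applied
  pointwise, as in \<open>\<lambda>x. dquot t (\<lambda>m. u m x) n\<close>. All are meant for indices \<open>n \<ge> 1\<close>.\<close>

definition step :: "(nat \<Rightarrow> real) \<Rightarrow> nat \<Rightarrow> real" where
  "step t n = t n - t (n - 1)"

text \<open>\<open>step t n\<close>, \<open>bdiff v n\<close>, \<open>dquot t v n\<close> stand for $\tau_n$, $\nabla_\tau v^n$, $\partial_\tau v^n$.\<close>

definition bdiff :: "(nat \<Rightarrow> real) \<Rightarrow> nat \<Rightarrow> real" where
  "bdiff v n = v n - v (n - 1)"

definition dquot :: "(nat \<Rightarrow> real) \<Rightarrow> (nat \<Rightarrow> real) \<Rightarrow> nat \<Rightarrow> real" where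
  "dquot t v n = bdiff v n / step t n"

definition D2 :: "real \<Rightarrow> (nat \<Rightarrow> real) \<Rightarrow> (nat \<Rightarrow> real) \<Rightarrow> (nat \<Rightarrow> real) \<Rightarrow> nat \<Rightarrow> real" where
  "D2 \<theta> t r v n =
     (if n = 1 then bdiff v 1 / step t 1
      else (1 + 2 * \<theta> * r n) / (step t n * (1 + r n)) * bdiff v n
         + (1 - 2 * \<theta>) * (r n)\<^sup>2 / (step t n * (1 + r n)) * bdiff v (n - 1))"

definition theta_mean :: "real \<Rightarrow> (nat \<Rightarrow> 'b::real_vector) \<Rightarrow> nat \<Rightarrow> 'b" where
  "theta_mean \<theta> v n = \<theta> *\<^sub>R v n + (1 - \<theta>) *\<^sub>R v (n - 1)"

text \<open>The bound on the step ratios. Note that \<open>root 3\<close> is the real cube root also for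
  negative arguments.\<close>

definition r_s :: "real \<Rightarrow> ereal" where
  "r_s \<theta> =
     (if \<theta> = 1/2 then \<infinity>
      else ereal
       (let E = 16 * \<theta>^4 + 48 * \<theta>^3 - 48 * \<theta>^2 + 12 * \<theta>;
            F = 16 * \<theta>^3 + 36 * \<theta>^2 - 36 * \<theta> + 9;
            G = 384 * \<theta>^5 + 912 * \<theta>^4 - 2496 * \<theta>^3 + 1944 * \<theta>^2 - 648 * \<theta> + 81
        in (4 * \<theta>^2
            - root 3 (- 4 * \<theta>^2 * E + 3 * (1 - 2 * \<theta>)^2 * ((- F + sqrt G) / 2))
            - root 3 (- 4 * \<theta>^2 * E + 3 * (1 - 2 * \<theta>)^2 * ((- F - sqrt G) / 2)))
           / (3 * (1 - 2 * \<theta>)^2)))"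


section \<open>The scheme and its discrete energy\<close>

text \<open>\<open>Du n\<close> is a weak gradient of \<open>u n\<close>; the data \<open>f\<close> are sampled at the grid points.\<close>

definition WSBDF2_solution ::
    "'a::euclidean_space set \<Rightarrow> real \<Rightarrow> nat \<Rightarrow> (nat \<Rightarrow> real) \<Rightarrow> (nat \<Rightarrow> real) \<Rightarrow> (real \<Rightarrow> 'a \<Rightarrow> real)
      \<Rightarrow> (nat \<Rightarrow> 'a \<Rightarrow> real) \<Rightarrow> (nat \<Rightarrow> 'a \<Rightarrow> 'a) \<Rightarrow> bool" where
  "WSBDF2_solution \<Omega> \<theta> N t r f u Du \<longleftrightarrow>
     (\<forall>n\<le>N. u n \<in> H01 \<Omega> \<and> has_weak_gradient \<Omega> (u n) (Du n)) \<and>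
     (\<forall>n\<in>{1..N}. \<forall>\<phi> D\<phi>. \<phi> \<in> H01 \<Omega> \<longrightarrow> has_weak_gradient \<Omega> \<phi> D\<phi> \<longrightarrow>
        L2_inner \<Omega> (\<lambda>x. D2 \<theta> t r (\<lambda>m. u m x) n) \<phi>
          + L2_inner \<Omega> (\<lambda>x. theta_mean \<theta> (\<lambda>m. Du m x) n) D\<phi>
        = L2_inner \<Omega> (\<lambda>x. theta_mean \<theta> (\<lambda>m. f (t m) x) n) \<phi>)"

definition energy ::
    "'a::euclidean_space set \<Rightarrow> real \<Rightarrow> (nat \<Rightarrow> real) \<Rightarrow> (nat \<Rightarrow> real)
      \<Rightarrow> (nat \<Rightarrow> 'a \<Rightarrow> real) \<Rightarrow> (nat \<Rightarrow> 'a \<Rightarrow> 'a) \<Rightarrow> nat \<Rightarrow> real" where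
  "energy \<Omega> \<theta> t r u Du k =
     (if k = 0 then (L2_norm \<Omega> (Du 0))\<^sup>2
      else (2 * \<theta> - 1) * r (k + 1) powr (3/2) / (1 + r (k + 1)) * step t k
             * (L2_norm \<Omega> (\<lambda>x. dquot t (\<lambda>m. u m x) k))\<^sup>2
           + (L2_norm \<Omega> (Du k))\<^sup>2)"

end

theory Submission
  imports Defs
begin

text \<open>
  The scheme is tested with the difference quotient \<open>\<partial>\<^sub>\<tau>u\<^sup>k\<close>, which is possible because \<open>H\<^sub>0\<^sup>1(\<Omega>)\<close> is
  linear (lemmas \<open>H01_lincomb\<close> and \<open>has_weak_gradient_lincomb\<close>). Since \<open>\<theta> \<ge> 1/2\<close>, the diffusion
  term dominates the increment of \<open>\<parallel>\<nabla>u\<parallel>\<^sup>2\<close>. The difference operator yields a multiple of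
  \<open>\<parallel>\<partial>\<^sub>\<tau>u\<^sup>k\<parallel>\<^sup>2\<close> and a mixed term with a nonpositive coefficient, and the Young inequality trades
  the latter against the kinetic energy of the preceding level. What remains of \<open>\<parallel>\<partial>\<^sub>\<tau>u\<^sup>k\<parallel>\<^sup>2\<close> must pay for the kinetic energy
  of the current level. In terms of the square roots of two consecutive ratios this is the scalar
  inequality \<open>ratio_weight_le\<close>; its extreme case is that of two equal ratios, where it becomes
  \<open>(2\<theta> - 1) r powr (3/2) \<le> 1 + 2\<theta> r\<close>. Squared, this is the cubic inequality whose limiting case
  defines \<open>r_s \<theta>\<close>; the closed form of \<open>r_s\<close> is identified as a root by Cardano's formula
  (\<open>cardano_root\<close>, \<open>weight_le_below_r_s\<close>). Together this is \<open>energy_increment_le\<close>.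

  For stability the increments are summed. The right-hand side pairs the source with differences
  of \<open>u\<close>; summation by parts moves the differences to the source (\<open>duality_sum_bound\<close>), and the
  Poincare inequality bounds \<open>\<parallel>u\<^sup>k\<parallel>\<close> by \<open>C\<close> times the root of the energy. At a time level where the
  energy is largest one power of its root cancels (\<open>maximum_bound\<close>). The factor \<open>4\<close> is the \<open>2\<close>
  of the dissipation law times the \<open>2\<close> of the summation by parts, where the variation of the source
  is counted once for the last boundary term and once for all other terms.
\<close>

section \<open>The inner product space of square integrable functions\<close>

lemma L2_lincomb:
  fixes f g :: "'a::euclidean_space \<Rightarrow> 'b::euclidean_space"
  assumes "f \<in> L2 \<Omega>" "g \<in> L2 \<Omega>"
  shows "(\<lambda>x. a *\<^sub>R f x + b *\<^sub>R g x) \<in> L2 \<Omega>"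
proof -
  have [measurable]: "f \<in> borel_measurable (lebesgue_on \<Omega>)" "g \<in> borel_measurable (lebesgue_on \<Omega>)"
    and int: "integrable (lebesgue_on \<Omega>) (\<lambda>x. 2 * a\<^sup>2 * (norm (f x))\<^sup>2 + 2 * b\<^sup>2 * (norm (g x))\<^sup>2)"
    using assms by (auto simp: L2_def)
  have bound: "(norm (a *\<^sub>R v + b *\<^sub>R w))\<^sup>2 \<le> 2 * a\<^sup>2 * (norm v)\<^sup>2 + 2 * b\<^sup>2 * (norm w)\<^sup>2"
    for v w :: 'b
  proof -
    have "(norm (a *\<^sub>R v + b *\<^sub>R w))\<^sup>2 \<le> (\<bar>a\<bar> * norm v + \<bar>b\<bar> * norm w)\<^sup>2"
      using norm_triangle_ineq[of "a *\<^sub>R v" "b *\<^sub>R w"] by (intro power_mono) auto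
    also have "\<dots> \<le> 2 * (\<bar>a\<bar> * norm v)\<^sup>2 + 2 * (\<bar>b\<bar> * norm w)\<^sup>2"
      using sum_squares_bound[of "\<bar>a\<bar> * norm v" "\<bar>b\<bar> * norm w"] by (simp add: power2_sum)
    finally show ?thesis by (simp add: power_mult_distrib)
  qed
  have "integrable (lebesgue_on \<Omega>) (\<lambda>x. (norm (a *\<^sub>R f x + b *\<^sub>R g x))\<^sup>2)"
    by (rule Bochner_Integration.integrable_bound[OF int]) (auto intro: order_trans[OF bound])
  then show ?thesis by (simp add: L2_def)
qed

lemma L2_inner_integrable:
  fixes f g :: "'a::euclidean_space \<Rightarrow> 'b::euclidean_space"
  assumes "f \<in> L2 \<Omega>" "g \<in> L2 \<Omega>"
  shows "integrable (lebesgue_on \<Omega>) (\<lambda>x. f x \<bullet> g x)"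
proof -
  have [measurable]: "f \<in> borel_measurable (lebesgue_on \<Omega>)" "g \<in> borel_measurable (lebesgue_on \<Omega>)"
    and int: "integrable (lebesgue_on \<Omega>) (\<lambda>x. (norm (f x))\<^sup>2 + (norm (g x))\<^sup>2)"
    using assms by (auto simp: L2_def)
  have "\<bar>f x \<bullet> g x\<bar> \<le> (norm (f x))\<^sup>2 + (norm (g x))\<^sup>2" for x
    using Cauchy_Schwarz_ineq2[of "f x" "g x"] sum_squares_bound[of "norm (f x)" "norm (g x)"]
      mult_nonneg_nonneg[OF norm_ge_zero[of "f x"] norm_ge_zero[of "g x"]] by linarith
  then show ?thesis
    by (intro Bochner_Integration.integrable_bound[OF int]) auto
qed

lemma L2_scaleR_integrable:
  fixes f :: "'a::euclidean_space \<Rightarrow> real" and g :: "'a \<Rightarrow> 'b::euclidean_space"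
  assumes "f \<in> L2 \<Omega>" "g \<in> L2 \<Omega>"
  shows "integrable (lebesgue_on \<Omega>) (\<lambda>x. f x *\<^sub>R g x)"
proof -
  have [measurable]: "f \<in> borel_measurable (lebesgue_on \<Omega>)" "g \<in> borel_measurable (lebesgue_on \<Omega>)"
    and int: "integrable (lebesgue_on \<Omega>) (\<lambda>x. (norm (f x))\<^sup>2 + (norm (g x))\<^sup>2)"
    using assms by (auto simp: L2_def)
  have "\<bar>f x\<bar> * norm (g x) \<le> (norm (f x))\<^sup>2 + (norm (g x))\<^sup>2" for x
    using sum_squares_bound[of "norm (f x)" "norm (g x)"]
      mult_nonneg_nonneg[OF norm_ge_zero[of "f x"] norm_ge_zero[of "g x"]]
    unfolding real_norm_def by linarith
  then show ?thesis
    by (intro Bochner_Integration.integrable_bound[OF int]) auto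
qed

lemma L2_inner_commute: "L2_inner \<Omega> f g = L2_inner \<Omega> g f"
  by (simp add: L2_inner_def inner_commute)

lemma L2_inner_lincomb_left:
  assumes "f \<in> L2 \<Omega>" "g \<in> L2 \<Omega>" "h \<in> L2 \<Omega>"
  shows "L2_inner \<Omega> (\<lambda>x. a *\<^sub>R f x + b *\<^sub>R g x) h = a * L2_inner \<Omega> f h + b * L2_inner \<Omega> g h"
  using L2_inner_integrable[OF assms(1,3)] L2_inner_integrable[OF assms(2,3)]
  by (simp add: L2_inner_def inner_add_left)

lemma L2_inner_lincomb_right:
  assumes "f \<in> L2 \<Omega>" "g \<in> L2 \<Omega>" "h \<in> L2 \<Omega>"
  shows "L2_inner \<Omega> h (\<lambda>x. a *\<^sub>R f x + b *\<^sub>R g x) = a * L2_inner \<Omega> h f + b * L2_inner \<Omega> h g"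
  using L2_inner_lincomb_left[OF assms] by (metis L2_inner_commute)

lemma L2_inner_self_nonneg: "0 \<le> L2_inner \<Omega> f f"
  by (simp add: L2_inner_def)

lemma L2_norm_nonneg: "0 \<le> L2_norm \<Omega> f"
  by (simp add: L2_norm_def L2_inner_self_nonneg)

lemma L2_norm_squared: "(L2_norm \<Omega> f)\<^sup>2 = L2_inner \<Omega> f f"
  by (simp add: L2_norm_def L2_inner_self_nonneg)

lemma L2_norm_squared_lincomb:
  assumes "f \<in> L2 \<Omega>" "g \<in> L2 \<Omega>"
  shows "(L2_norm \<Omega> (\<lambda>x. a *\<^sub>R f x + b *\<^sub>R g x))\<^sup>2
    = a\<^sup>2 * (L2_norm \<Omega> f)\<^sup>2 + 2 * a * b * L2_inner \<Omega> f g + b\<^sup>2 * (L2_norm \<Omega> g)\<^sup>2"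
  unfolding L2_norm_squared
  by (simp add: L2_inner_lincomb_left L2_inner_lincomb_right L2_lincomb assms
      L2_inner_commute[of \<Omega> g f] power2_eq_square algebra_simps)

lemma L2_Cauchy_Schwarz:
  assumes "f \<in> L2 \<Omega>" "g \<in> L2 \<Omega>"
  shows "\<bar>L2_inner \<Omega> f g\<bar> \<le> L2_norm \<Omega> f * L2_norm \<Omega> g"
proof -
  let ?p = "(L2_norm \<Omega> f)\<^sup>2" and ?q = "(L2_norm \<Omega> g)\<^sup>2" and ?m = "L2_inner \<Omega> f g"
  have quad: "0 \<le> a\<^sup>2 * ?p + 2 * a * b * ?m + b\<^sup>2 * ?q" for a b
    using L2_norm_squared_lincomb[OF assms, of a b] zero_le_power2 by metis
  have "?m\<^sup>2 \<le> ?p * ?q"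
  proof (cases "?q = 0")
    case True
    have "?m = 0"
    proof (rule ccontr)
      assume "?m \<noteq> 0"
      then show False using quad[of 1 "- (?p + 1) / (2 * ?m)"] True by (simp add: field_simps)
    qed
    then show ?thesis by simp
  next
    case False
    then have q: "?q > 0" by simp
    have "0 \<le> ?q * (?p * ?q - ?m\<^sup>2)"
      using quad[of ?q "- ?m"] by (simp add: power2_eq_square algebra_simps)
    then show ?thesis using q by (simp add: zero_le_mult_iff)
  qed
  then have "\<bar>?m\<bar>\<^sup>2 \<le> (L2_norm \<Omega> f * L2_norm \<Omega> g)\<^sup>2" by (simp add: power_mult_distrib)
  then show ?thesis by (rule power2_le_imp_le) (simp add: L2_norm_nonneg)
qed

lemma L2_norm_lincomb_le:
  assumes "f \<in> L2 \<Omega>" "g \<in> L2 \<Omega>"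
  shows "L2_norm \<Omega> (\<lambda>x. a *\<^sub>R f x + b *\<^sub>R g x) \<le> \<bar>a\<bar> * L2_norm \<Omega> f + \<bar>b\<bar> * L2_norm \<Omega> g"
proof (rule power2_le_imp_le)
  have "a * b * L2_inner \<Omega> f g \<le> \<bar>a * b\<bar> * \<bar>L2_inner \<Omega> f g\<bar>"
    by (metis abs_ge_self abs_mult)
  also have "\<dots> \<le> \<bar>a * b\<bar> * (L2_norm \<Omega> f * L2_norm \<Omega> g)"
    by (intro mult_left_mono L2_Cauchy_Schwarz assms) simp
  finally show "(L2_norm \<Omega> (\<lambda>x. a *\<^sub>R f x + b *\<^sub>R g x))\<^sup>2
      \<le> (\<bar>a\<bar> * L2_norm \<Omega> f + \<bar>b\<bar> * L2_norm \<Omega> g)\<^sup>2"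
    by (simp add: L2_norm_squared_lincomb assms power2_sum power_mult_distrib abs_mult mult_ac)
qed (simp add: L2_norm_nonneg)

section \<open>Linearity of weak gradients and of $H_0^1$\<close>

text \<open>A continuous function is bounded on the compact closure of \<open>\<Omega>\<close>, and \<open>\<Omega>\<close> has finite measure.
  This puts test functions and their gradients into \<open>L\<^sup>2\<close>, so that the integrals that define weak
  gradients and \<open>H\<^sub>0\<^sup>1\<close> can be split along linear combinations.\<close>

lemma continuous_in_L2:
  fixes h :: "'a::euclidean_space \<Rightarrow> 'b::euclidean_space"
  assumes cont: "continuous_on UNIV h" and \<Omega>: "open \<Omega>" "bounded \<Omega>"
  shows "h \<in> L2 \<Omega>"
proof -
  have lm: "\<Omega> \<in> lmeasurable" using \<Omega> by (simp add: bounded_set_imp_lmeasurable)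
  have "continuous_on \<Omega> h" using cont continuous_on_subset by blast
  then have [measurable]: "h \<in> borel_measurable (lebesgue_on \<Omega>)"
    using lm by (intro continuous_imp_measurable_on_sets_lebesgue) auto
  have "compact (h ` closure \<Omega>)"
    using \<Omega> cont by (intro compact_continuous_image) (auto intro: continuous_on_subset)
  then obtain B where B: "\<And>x. x \<in> closure \<Omega> \<Longrightarrow> norm (h x) \<le> B"
    by (meson bounded_iff compact_imp_bounded image_eqI)
  have "AE x in lebesgue_on \<Omega>. norm ((norm (h x))\<^sup>2) \<le> B\<^sup>2"
    using B closure_subset by (intro AE_I2) (auto intro!: power_mono)
  then have "integrable (lebesgue_on \<Omega>) (\<lambda>x. (norm (h x))\<^sup>2)"
    by (intro finite_measure.integrable_const_bound[OF finite_measure_lebesgue_on[OF lm]]) auto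
  then show ?thesis by (simp add: L2_def)
qed

lemma GDERIV_lincomb:
  assumes "GDERIV f x :> df" "GDERIV g x :> dg"
  shows "GDERIV (\<lambda>x. a *\<^sub>R f x + b *\<^sub>R g x) x :> a *\<^sub>R df + b *\<^sub>R dg"
  using assms unfolding gderiv_def
  by (auto intro!: derivative_eq_intros simp: inner_add_right)

lemma GDERIV_unique:
  assumes "GDERIV f x :> d" "GDERIV f x :> d'"
  shows "d = d'"
proof -
  have "(\<lambda>h. h \<bullet> d) = (\<lambda>h. h \<bullet> d')"
    using assms unfolding gderiv_def by (rule has_derivative_unique)
  then show ?thesis by (metis inner_commute vector_eq_rdot)
qed

lemma Ck_lincomb: "Ck k \<phi> \<Longrightarrow> Ck k \<psi> \<Longrightarrow> Ck k (\<lambda>x. a *\<^sub>R \<phi> x + b *\<^sub>R \<psi> x)"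
proof (induction k arbitrary: \<phi> \<psi>)
  case 0
  then show ?case by (auto intro!: continuous_intros)
next
  case (Suc k)
  from Suc.prems obtain D\<phi> D\<psi> where
    D: "\<forall>x. GDERIV \<phi> x :> D\<phi> x" "\<forall>x. GDERIV \<psi> x :> D\<psi> x" and
    Ck: "\<forall>i\<in>Basis. Ck k (\<lambda>x. D\<phi> x \<bullet> i)" "\<forall>i\<in>Basis. Ck k (\<lambda>x. D\<psi> x \<bullet> i)" by auto
  have "\<forall>i\<in>Basis. Ck k (\<lambda>x. (a *\<^sub>R D\<phi> x + b *\<^sub>R D\<psi> x) \<bullet> i)"
    using Suc.IH Ck by (simp add: inner_add_left)
  with D show ?case
    by (auto intro!: exI[of _ "\<lambda>x. a *\<^sub>R D\<phi> x + b *\<^sub>R D\<psi> x"] GDERIV_lincomb simp del: real_scaleR_def)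
qed

lemma test_fun_lincomb:
  assumes "test_fun \<Omega> \<phi>" "test_fun \<Omega> \<psi>"
  shows "test_fun \<Omega> (\<lambda>x. a *\<^sub>R \<phi> x + b *\<^sub>R \<psi> x)"
proof -
  let ?S = "\<lambda>h::'a \<Rightarrow> real. closure {x. h x \<noteq> 0}"
  have "{x. a *\<^sub>R \<phi> x + b *\<^sub>R \<psi> x \<noteq> 0} \<subseteq> {x. \<phi> x \<noteq> 0} \<union> {x. \<psi> x \<noteq> 0}" by auto
  then have sub: "?S (\<lambda>x. a *\<^sub>R \<phi> x + b *\<^sub>R \<psi> x) \<subseteq> ?S \<phi> \<union> ?S \<psi>"
    unfolding closure_Un[symmetric] by (rule closure_mono)
  have "compact (?S \<phi> \<union> ?S \<psi>)" using assms by (intro compact_Un) (auto simp: test_fun_def)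
  then have "compact ((?S \<phi> \<union> ?S \<psi>) \<inter> ?S (\<lambda>x. a *\<^sub>R \<phi> x + b *\<^sub>R \<psi> x))"
    by (rule compact_Int_closed) (rule closed_closure)
  then have comp: "compact (?S (\<lambda>x. a *\<^sub>R \<phi> x + b *\<^sub>R \<psi> x))" using sub by (simp only: inf.absorb2)
  have "?S \<phi> \<union> ?S \<psi> \<subseteq> \<Omega>" using assms by (simp add: test_fun_def)
  then show ?thesis
    unfolding test_fun_def using sub comp assms by (blast intro: Ck_lincomb dest: test_fun_def[THEN iffD1])
qed

lemma test_fun_in_L2:
  assumes \<Omega>: "open \<Omega>" "bounded \<Omega>" and \<phi>: "test_fun \<Omega> \<phi>" "\<forall>x. GDERIV \<phi> x :> D\<phi> x"
  shows "\<phi> \<in> L2 \<Omega>" "D\<phi> \<in> L2 \<Omega>"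
proof -
  have "Ck 0 \<phi>" "Ck (Suc 0) \<phi>" using \<phi> unfolding test_fun_def by blast+
  then obtain D' where cont: "continuous_on UNIV \<phi>"
    and D': "\<forall>x. GDERIV \<phi> x :> D' x" "\<forall>i\<in>Basis. continuous_on UNIV (\<lambda>x. D' x \<bullet> i)" by auto
  have "D' = D\<phi>" using D'(1) \<phi>(2) GDERIV_unique by blast
  then have "continuous_on UNIV D\<phi>" using D'(2) by (subst continuous_on_componentwise) simp
  with cont show "\<phi> \<in> L2 \<Omega>" "D\<phi> \<in> L2 \<Omega>" by (auto intro: continuous_in_L2 \<Omega>)
qed

lemma has_weak_gradient_in_L2:
  assumes "has_weak_gradient \<Omega> u g"
  shows "u \<in> L2 \<Omega>" "g \<in> L2 \<Omega>"
  using assms by (auto simp: has_weak_gradient_def)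

lemma has_weak_gradient_lincomb:
  assumes \<Omega>: "open \<Omega>" "bounded \<Omega>"
    and u: "has_weak_gradient \<Omega> u gu" and v: "has_weak_gradient \<Omega> v gv"
  shows "has_weak_gradient \<Omega> (\<lambda>x. a *\<^sub>R u x + b *\<^sub>R v x) (\<lambda>x. a *\<^sub>R gu x + b *\<^sub>R gv x)"
  unfolding has_weak_gradient_def
proof (intro conjI allI impI)
  note L2 = has_weak_gradient_in_L2[OF u] has_weak_gradient_in_L2[OF v]
  show "(\<lambda>x. a *\<^sub>R u x + b *\<^sub>R v x) \<in> L2 \<Omega>" "(\<lambda>x. a *\<^sub>R gu x + b *\<^sub>R gv x) \<in> L2 \<Omega>"
    using L2 by (auto intro: L2_lincomb simp del: real_scaleR_def)
  fix \<phi> D\<phi> assume \<phi>: "test_fun \<Omega> \<phi>" "\<forall>x. GDERIV \<phi> x :> D\<phi> x"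
  note \<phi>L2 = test_fun_in_L2[OF \<Omega> \<phi>]
  note int = L2_scaleR_integrable[OF L2(1) \<phi>L2(2)] L2_scaleR_integrable[OF L2(3) \<phi>L2(2)]
    L2_scaleR_integrable[OF \<phi>L2(1) L2(2)] L2_scaleR_integrable[OF \<phi>L2(1) L2(4)]
  have parts: "(LINT x|lebesgue_on \<Omega>. u x *\<^sub>R D\<phi> x) = - (LINT x|lebesgue_on \<Omega>. \<phi> x *\<^sub>R gu x)"
    "(LINT x|lebesgue_on \<Omega>. v x *\<^sub>R D\<phi> x) = - (LINT x|lebesgue_on \<Omega>. \<phi> x *\<^sub>R gv x)"
    using u v \<phi> unfolding has_weak_gradient_def by blast+
  have "(LINT x|lebesgue_on \<Omega>. (a *\<^sub>R u x + b *\<^sub>R v x) *\<^sub>R D\<phi> x)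
      = (LINT x|lebesgue_on \<Omega>. a *\<^sub>R (u x *\<^sub>R D\<phi> x) + b *\<^sub>R (v x *\<^sub>R D\<phi> x))"
    by (simp add: scaleR_add_left)
  also have "\<dots> = a *\<^sub>R (LINT x|lebesgue_on \<Omega>. u x *\<^sub>R D\<phi> x) + b *\<^sub>R (LINT x|lebesgue_on \<Omega>. v x *\<^sub>R D\<phi> x)"
    by (simp add: int del: scaleR_scaleR)
  also have "\<dots> = - (a *\<^sub>R (LINT x|lebesgue_on \<Omega>. \<phi> x *\<^sub>R gu x) + b *\<^sub>R (LINT x|lebesgue_on \<Omega>. \<phi> x *\<^sub>R gv x))"
    unfolding parts by simp
  also have "a *\<^sub>R (LINT x|lebesgue_on \<Omega>. \<phi> x *\<^sub>R gu x) + b *\<^sub>R (LINT x|lebesgue_on \<Omega>. \<phi> x *\<^sub>R gv x)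
      = (LINT x|lebesgue_on \<Omega>. a *\<^sub>R (\<phi> x *\<^sub>R gu x) + b *\<^sub>R (\<phi> x *\<^sub>R gv x))"
    by (simp add: int del: scaleR_scaleR)
  also have "\<dots> = (LINT x|lebesgue_on \<Omega>. \<phi> x *\<^sub>R (a *\<^sub>R gu x + b *\<^sub>R gv x))"
    by (simp add: scaleR_add_right mult.commute)
  finally show "(LINT x|lebesgue_on \<Omega>. (a *\<^sub>R u x + b *\<^sub>R v x) *\<^sub>R D\<phi> x)
      = - (LINT x|lebesgue_on \<Omega>. \<phi> x *\<^sub>R (a *\<^sub>R gu x + b *\<^sub>R gv x))" .
qed

lemma L2_norm_lincomb_tendsto_0:
  fixes F G :: "nat \<Rightarrow> 'a::euclidean_space \<Rightarrow> 'b::euclidean_space"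
  assumes L2: "f \<in> L2 \<Omega>" "\<And>j. F j \<in> L2 \<Omega>" "g \<in> L2 \<Omega>" "\<And>j. G j \<in> L2 \<Omega>"
    and lim: "(\<lambda>j. L2_norm \<Omega> (\<lambda>x. f x - F j x)) \<longlonglongrightarrow> 0" "(\<lambda>j. L2_norm \<Omega> (\<lambda>x. g x - G j x)) \<longlonglongrightarrow> 0"
  shows "(\<lambda>j. L2_norm \<Omega> (\<lambda>x. (a *\<^sub>R f x + b *\<^sub>R g x) - (a *\<^sub>R F j x + b *\<^sub>R G j x))) \<longlonglongrightarrow> 0"
proof (rule tendsto_sandwich[OF _ _ tendsto_const])
  show "\<forall>\<^sub>F j in sequentially. 0 \<le> L2_norm \<Omega> (\<lambda>x. (a *\<^sub>R f x + b *\<^sub>R g x) - (a *\<^sub>R F j x + b *\<^sub>R G j x))"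
    by (simp add: L2_norm_nonneg)
  have diff: "(\<lambda>x. f x - F j x) \<in> L2 \<Omega>" "(\<lambda>x. g x - G j x) \<in> L2 \<Omega>" for j
    using L2_lincomb[OF L2(1) L2(2)[of j], of 1 "-1"] L2_lincomb[OF L2(3) L2(4)[of j], of 1 "-1"] by auto
  show "\<forall>\<^sub>F j in sequentially. L2_norm \<Omega> (\<lambda>x. (a *\<^sub>R f x + b *\<^sub>R g x) - (a *\<^sub>R F j x + b *\<^sub>R G j x))
     \<le> \<bar>a\<bar> * L2_norm \<Omega> (\<lambda>x. f x - F j x) + \<bar>b\<bar> * L2_norm \<Omega> (\<lambda>x. g x - G j x)"
    using L2_norm_lincomb_le[OF diff, where a=a and b=b] by (intro always_eventually) (simp add: algebra_simps)
  show "(\<lambda>j. \<bar>a\<bar> * L2_norm \<Omega> (\<lambda>x. f x - F j x) + \<bar>b\<bar> * L2_norm \<Omega> (\<lambda>x. g x - G j x)) \<longlonglongrightarrow> 0"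
    using tendsto_add[OF tendsto_mult_left[OF lim(1), of "\<bar>a\<bar>"] tendsto_mult_left[OF lim(2), of "\<bar>b\<bar>"]] by simp
qed

text \<open>The difference quotients of a discrete solution are admissible test functions because
  \<open>H\<^sub>0\<^sup>1\<close> is a linear space; the same combination of approximating test functions approximates the
  combination.\<close>

lemma H01_lincomb:
  assumes \<Omega>: "open \<Omega>" "bounded \<Omega>" and u: "u \<in> H01 \<Omega>" and v: "v \<in> H01 \<Omega>"
  shows "(\<lambda>x. a *\<^sub>R u x + b *\<^sub>R v x) \<in> H01 \<Omega>"
proof -
  obtain gu \<phi> D\<phi> where gu: "has_weak_gradient \<Omega> u gu"
    and \<phi>: "\<And>j. test_fun \<Omega> (\<phi> j)" "\<And>j. \<forall>x. GDERIV (\<phi> j) x :> D\<phi> j x"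
      "(\<lambda>j::nat. L2_norm \<Omega> (\<lambda>x. u x - \<phi> j x)) \<longlonglongrightarrow> 0"
      "(\<lambda>j::nat. L2_norm \<Omega> (\<lambda>x. gu x - D\<phi> j x)) \<longlonglongrightarrow> 0"
    using u unfolding H01_def by blast
  obtain gv \<psi> D\<psi> where gv: "has_weak_gradient \<Omega> v gv"
    and \<psi>: "\<And>j. test_fun \<Omega> (\<psi> j)" "\<And>j. \<forall>x. GDERIV (\<psi> j) x :> D\<psi> j x"
      "(\<lambda>j::nat. L2_norm \<Omega> (\<lambda>x. v x - \<psi> j x)) \<longlonglongrightarrow> 0"
      "(\<lambda>j::nat. L2_norm \<Omega> (\<lambda>x. gv x - D\<psi> j x)) \<longlonglongrightarrow> 0"
    using v unfolding H01_def by blast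
  note \<phi>L2 = test_fun_in_L2[OF \<Omega> \<phi>(1,2)] and \<psi>L2 = test_fun_in_L2[OF \<Omega> \<psi>(1,2)]
  note uL2 = has_weak_gradient_in_L2[OF gu] and vL2 = has_weak_gradient_in_L2[OF gv]
  show ?thesis
    unfolding H01_def mem_Collect_eq
  proof (intro exI conjI allI)
    show "has_weak_gradient \<Omega> (\<lambda>x. a *\<^sub>R u x + b *\<^sub>R v x) (\<lambda>x. a *\<^sub>R gu x + b *\<^sub>R gv x)"
      by (rule has_weak_gradient_lincomb[OF \<Omega> gu gv])
    show "test_fun \<Omega> (\<lambda>x. a *\<^sub>R \<phi> j x + b *\<^sub>R \<psi> j x)" for j
      by (rule test_fun_lincomb[OF \<phi>(1) \<psi>(1)])
    show "GDERIV (\<lambda>x. a *\<^sub>R \<phi> j x + b *\<^sub>R \<psi> j x) x :> a *\<^sub>R D\<phi> j x + b *\<^sub>R D\<psi> j x" for j x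
      using \<phi>(2) \<psi>(2) by (intro GDERIV_lincomb) auto
    show "(\<lambda>j. L2_norm \<Omega> (\<lambda>x. (a *\<^sub>R u x + b *\<^sub>R v x) - (a *\<^sub>R \<phi> j x + b *\<^sub>R \<psi> j x))) \<longlonglongrightarrow> 0"
      by (rule L2_norm_lincomb_tendsto_0[OF uL2(1) \<phi>L2(1) vL2(1) \<psi>L2(1) \<phi>(3) \<psi>(3)])
    show "(\<lambda>j. L2_norm \<Omega> (\<lambda>x. (a *\<^sub>R gu x + b *\<^sub>R gv x) - (a *\<^sub>R D\<phi> j x + b *\<^sub>R D\<psi> j x))) \<longlonglongrightarrow> 0"
      by (rule L2_norm_lincomb_tendsto_0[OF uL2(2) \<phi>L2(2) vL2(2) \<psi>L2(2) \<phi>(4) \<psi>(4)])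
  qed
qed

section \<open>The limiting step ratio\<close>

text \<open>In the cubic \<open>a x\<^sup>3 + b x\<^sup>2 + c x + d\<close> the substitution \<open>w = 3 a x + b\<close> leaves the depressed cubic
  \<open>w\<^sup>3 - 3 A w + (2 b A - 3 a B) = 0\<close>. The two radicals \<open>y\<close>, \<open>z\<close> satisfy \<open>y\<^sup>3 + z\<^sup>3 = 2 b A - 3 a B\<close> and
  \<open>y z = A\<close>, so \<open>w = - (y + z)\<close> solves it by the expansion of \<open>(y + z)\<^sup>3\<close>. The discriminant
  condition makes both radicals real.\<close>

lemma cardano_root:
  fixes a b c d :: real
  defines "A \<equiv> b\<^sup>2 - 3 * a * c" and "B \<equiv> b * c - 9 * a * d" and "C \<equiv> c\<^sup>2 - 3 * b * d"
  assumes a: "a \<noteq> 0" and disc: "B\<^sup>2 - 4 * A * C \<ge> 0"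
  defines "y \<equiv> root 3 (b * A + 3 * a * ((- B + sqrt (B\<^sup>2 - 4 * A * C)) / 2))"
    and "z \<equiv> root 3 (b * A + 3 * a * ((- B - sqrt (B\<^sup>2 - 4 * A * C)) / 2))"
  defines "x \<equiv> (- b - y - z) / (3 * a)"
  shows "a * x ^ 3 + b * x\<^sup>2 + c * x + d = 0"
proof -
  define D where "D = sqrt (B\<^sup>2 - 4 * A * C)"
  have D2: "D\<^sup>2 = B\<^sup>2 - 4 * A * C" using disc by (simp add: D_def)
  have y3: "y ^ 3 = b * A + 3 * a * ((- B + D) / 2)" and z3: "z ^ 3 = b * A + 3 * a * ((- B - D) / 2)"
    by (simp_all add: y_def z_def D_def odd_real_root_pow)
  have "(y * z) ^ 3 = (b * A - 3 * a * B / 2)\<^sup>2 - (3 * a / 2)\<^sup>2 * D\<^sup>2"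
    by (simp add: power_mult_distrib y3 z3 power2_eq_square field_simps)
  also have "\<dots> = A ^ 3"
    unfolding D2 A_def B_def C_def by (simp add: power2_eq_square power3_eq_cube field_simps)
  finally have yz: "y * z = A"
    by (metis odd_numeral odd_real_root_power_cancel)
  have "(y + z) ^ 3 = y ^ 3 + z ^ 3 + 3 * (y * z) * (y + z)"
    by (simp add: power3_eq_cube algebra_simps)
  then have cub: "(y + z) ^ 3 = 2 * b * A - 3 * a * B + 3 * A * (y + z)"
    by (simp add: y3 z3 yz field_simps)
  have yz_x: "y + z = - (3 * a * x + b)" using a by (simp add: x_def field_simps)
  have "27 * a\<^sup>2 * (a * x ^ 3 + b * x\<^sup>2 + c * x + d) = 0"
    using cub unfolding yz_x A_def B_def
    by (simp add: power2_eq_square power3_eq_cube algebra_simps)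
  then show ?thesis using a by simp
qed

text \<open>The closed form of \<open>r_s\<close> is the previous root formula for the coefficients
  \<open>(1 - 2\<theta>)\<^sup>2, -4\<theta>\<^sup>2, -4\<theta>, -1\<close>. Its discriminant has the double zero \<open>\<theta> = 1/2\<close>:
  \<open>G = (2\<theta> - 1)\<^sup>2 (96\<theta>\<^sup>3 + 81 (2\<theta> - 1)\<^sup>2)\<close>, hence \<open>G \<ge> 0\<close>.\<close>

lemma r_s_root:
  assumes \<theta>: "1/2 < \<theta>"
  obtains x where "r_s \<theta> = ereal x" "(1 - 2 * \<theta>)\<^sup>2 * x ^ 3 - 4 * \<theta>\<^sup>2 * x\<^sup>2 - 4 * \<theta> * x - 1 = 0"
proof -
  define a b c d where abcd: "a = (1 - 2 * \<theta>)\<^sup>2" "b = - 4 * \<theta>\<^sup>2" "c = - 4 * \<theta>" "d = - (1::real)"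
  define E F G where EFG: "E = 16 * \<theta>^4 + 48 * \<theta>^3 - 48 * \<theta>\<^sup>2 + 12 * \<theta>"
    "F = 16 * \<theta>^3 + 36 * \<theta>\<^sup>2 - 36 * \<theta> + 9"
    "G = 384 * \<theta>^5 + 912 * \<theta>^4 - 2496 * \<theta>^3 + 1944 * \<theta>\<^sup>2 - 648 * \<theta> + 81"
  have A: "b\<^sup>2 - 3 * a * c = E" and B: "b * c - 9 * a * d = F"
    and disc: "F\<^sup>2 - 4 * E * (c\<^sup>2 - 3 * b * d) = G"
    unfolding abcd EFG by (simp_all add: algebra_simps power_numeral_reduce)
  have "G = (2 * \<theta> - 1)\<^sup>2 * (96 * \<theta> ^ 3 + 81 * (2 * \<theta> - 1)\<^sup>2)"
    unfolding EFG by (simp add: algebra_simps power_numeral_reduce)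
  then have "G \<ge> 0" using \<theta> by simp
  moreover have "a \<noteq> 0" using \<theta> by (simp add: abcd)
  ultimately have root: "a * x ^ 3 + b * x\<^sup>2 + c * x + d = 0"
    if "x = (- b - root 3 (b * E + 3 * a * ((- F + sqrt G) / 2)) - root 3 (b * E + 3 * a * ((- F - sqrt G) / 2))) / (3 * a)"
    for x
    using cardano_root[of a b c d] that unfolding A B disc by blast
  show thesis
  proof (rule that)
    show "r_s \<theta> = ereal ((- b - root 3 (b * E + 3 * a * ((- F + sqrt G) / 2)) - root 3 (b * E + 3 * a * ((- F - sqrt G) / 2))) / (3 * a))"
      using \<theta> unfolding r_s_def Let_def abcd EFG by simp
  qed (use root in \<open>auto simp: abcd\<close>)
qed

text \<open>The cubic equation for \<open>x = r_s \<theta>\<close> says \<open>(2\<theta> - 1)\<^sup>2 x\<^sup>3 = (1 + 2\<theta> x)\<^sup>2\<close>, the claimed inequality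
  at \<open>r = x\<close> with equality and squared. It passes to smaller \<open>r\<close> because
  \<open>(1 + 2\<theta> r)\<^sup>2 / r\<^sup>3\<close> decreases in \<open>r\<close>. For \<open>\<theta> = 1/2\<close> the left-hand side vanishes.\<close>

lemma weight_le_below_r_s:
  assumes \<theta>: "1/2 \<le> \<theta>" and r: "0 < r" "ereal r \<le> r_s \<theta>"
  shows "(2 * \<theta> - 1) * sqrt r ^ 3 \<le> 1 + 2 * \<theta> * r"
proof (cases "\<theta> = 1/2")
  case True
  show ?thesis unfolding True using r by simp
next
  case False
  then have \<theta>': "1/2 < \<theta>" using \<theta> by simp
  obtain x where x: "r_s \<theta> = ereal x"
    "(1 - 2 * \<theta>)\<^sup>2 * x ^ 3 - 4 * \<theta>\<^sup>2 * x\<^sup>2 - 4 * \<theta> * x - 1 = 0"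
    using r_s_root[OF \<theta>'] .
  have rx: "r \<le> x" using r x by simp
  then have x0: "x > 0" using r by simp
  have root: "(2 * \<theta> - 1)\<^sup>2 * x ^ 3 = (1 + 2 * \<theta> * x)\<^sup>2"
    using x(2) by (simp add: power2_eq_square algebra_simps)
  have "x * r * ((2 * \<theta> - 1)\<^sup>2 * (x * r)) * ((2 * \<theta> - 1)\<^sup>2 * 0) = 0" by simp
  have le: "r * (1 + 2 * \<theta> * x) \<le> x * (1 + 2 * \<theta> * r)" using rx by (simp add: algebra_simps)
  have "x ^ 3 * ((2 * \<theta> - 1)\<^sup>2 * r ^ 3) = r ^ 3 * (1 + 2 * \<theta> * x)\<^sup>2"
    unfolding root[symmetric] by simp
  also have "\<dots> = r * (r * (1 + 2 * \<theta> * x))\<^sup>2" by (simp add: power2_eq_square power3_eq_cube)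
  also have "\<dots> \<le> x * (x * (1 + 2 * \<theta> * r))\<^sup>2"
    by (rule mult_mono[OF rx power_mono[OF le]]) (use r x0 \<theta> in auto)
  also have "\<dots> = x ^ 3 * (1 + 2 * \<theta> * r)\<^sup>2" by (simp add: power2_eq_square power3_eq_cube)
  finally have "(2 * \<theta> - 1)\<^sup>2 * r ^ 3 \<le> (1 + 2 * \<theta> * r)\<^sup>2" using x0 by simp
  moreover have "(sqrt r ^ 3)\<^sup>2 = ((sqrt r)\<^sup>2) ^ 3" by (simp flip: power_mult)
  then have "((2 * \<theta> - 1) * sqrt r ^ 3)\<^sup>2 = (2 * \<theta> - 1)\<^sup>2 * r ^ 3"
    using r by (simp add: power_mult_distrib)
  ultimately have "((2 * \<theta> - 1) * sqrt r ^ 3)\<^sup>2 \<le> (1 + 2 * \<theta> * r)\<^sup>2" by simp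
  then show ?thesis by (rule power2_le_imp_le) (use \<theta> r in simp)
qed

section \<open>Coercivity of the difference operator\<close>

text \<open>Here \<open>s\<^sup>2\<close> and \<open>\<rho>\<^sup>2\<close> stand for two consecutive step ratios and \<open>c = 2\<theta> - 1\<close>. The left-hand side is
  the energy weight created at the new time level, the right-hand side is what the scheme still
  offers after the mixed term has been absorbed. For \<open>s = \<rho>\<close> the claim, multiplied by \<open>1 + s\<^sup>2\<close>, is twice
  the hypothesis on \<open>s\<close>. The weight \<open>\<rho>\<^sup>3 / (1 + \<rho>\<^sup>2)\<close> increases, which reduces \<open>\<rho> \<le> s\<close> to \<open>s = \<rho>\<close>;
  \<open>(2 s\<^sup>2 - s\<^sup>3) / (1 + s\<^sup>2)\<close> decreases for \<open>s \<ge> 2\<close>, which reduces \<open>2 \<le> s \<le> \<rho>\<close> to the same case; and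
  for \<open>s \<le> 2\<close> it is nonnegative, while the weight is at most \<open>2\<close> by the hypothesis on \<open>\<rho>\<close> and
  \<open>c \<le> 1\<close>.\<close>

lemma ratio_weight_le:
  fixes c s \<rho> :: real
  assumes c: "0 \<le> c" "c \<le> 1" and s: "0 \<le> s" "c * s ^ 3 \<le> 1 + s\<^sup>2 + c * s\<^sup>2"
    and \<rho>: "0 \<le> \<rho>" "c * \<rho> ^ 3 \<le> 1 + \<rho>\<^sup>2 + c * \<rho>\<^sup>2"
  shows "c * \<rho> ^ 3 / (1 + \<rho>\<^sup>2) \<le> 2 + c * (2 * s\<^sup>2 - s ^ 3) / (1 + s\<^sup>2)"
proof -
  have pos: "1 + x\<^sup>2 > 0" for x :: real by (simp add: add_pos_nonneg)
  have diag: "c * x ^ 3 / (1 + x\<^sup>2) \<le> 2 + c * (2 * x\<^sup>2 - x ^ 3) / (1 + x\<^sup>2)"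
    if "c * x ^ 3 \<le> 1 + x\<^sup>2 + c * x\<^sup>2" for x
  proof -
    have "c * x ^ 3 / (1 + x\<^sup>2) \<le> (2 * (1 + x\<^sup>2) + c * (2 * x\<^sup>2 - x ^ 3)) / (1 + x\<^sup>2)"
      using that pos[of x] by (intro divide_right_mono) (auto simp: algebra_simps)
    also have "\<dots> = 2 + c * (2 * x\<^sup>2 - x ^ 3) / (1 + x\<^sup>2)"
      using pos[of x] by (subst add_divide_distrib) (simp del: distrib_left_numeral)
    finally show ?thesis .
  qed
  consider "\<rho> \<le> s" | "s \<le> \<rho>" "s \<le> 2" | "s \<le> \<rho>" "2 \<le> s" by linarith
  then show ?thesis
  proof cases
    case 1
    have "s ^ 3 * (1 + \<rho>\<^sup>2) - \<rho> ^ 3 * (1 + s\<^sup>2) = (s - \<rho>) * (s\<^sup>2 + s * \<rho> + \<rho>\<^sup>2 + s\<^sup>2 * \<rho>\<^sup>2)"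
      by (simp add: power2_eq_square power3_eq_cube algebra_simps)
    also have "\<dots> \<ge> 0" using 1 s \<rho> by simp
    finally have "\<rho> ^ 3 / (1 + \<rho>\<^sup>2) \<le> s ^ 3 / (1 + s\<^sup>2)"
      using pos[of s] pos[of \<rho>] by (simp add: field_simps)
    then have "c * (\<rho> ^ 3 / (1 + \<rho>\<^sup>2)) \<le> c * (s ^ 3 / (1 + s\<^sup>2))" using c by (rule_tac mult_left_mono)
    then show ?thesis using diag[OF s(2)] by simp
  next
    case 2
    note \<rho>(2)
    also have "c * \<rho>\<^sup>2 \<le> \<rho>\<^sup>2" using c by (simp add: mult_left_le_one_le)
    finally have "c * \<rho> ^ 3 \<le> 2 * (1 + \<rho>\<^sup>2)" by simp
    then have "c * \<rho> ^ 3 / (1 + \<rho>\<^sup>2) \<le> 2" using pos[of \<rho>] by (simp add: field_simps)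
    moreover have "2 * s\<^sup>2 - s ^ 3 = s\<^sup>2 * (2 - s)" by (simp add: power2_eq_square power3_eq_cube algebra_simps)
    then have "0 \<le> c * (2 * s\<^sup>2 - s ^ 3) / (1 + s\<^sup>2)" using c 2 by simp
    ultimately show ?thesis by linarith
  next
    case 3
    have "(2 * s\<^sup>2 - s ^ 3) * (1 + \<rho>\<^sup>2) - (2 * \<rho>\<^sup>2 - \<rho> ^ 3) * (1 + s\<^sup>2)
        = (\<rho> - s) * (\<rho> * (\<rho> - 2) + s * (s - 2) + \<rho> * s + s\<^sup>2 * \<rho>\<^sup>2)"
      by (simp add: power2_eq_square power3_eq_cube algebra_simps)
    also have "\<dots> \<ge> 0" using 3 by (intro mult_nonneg_nonneg add_nonneg_nonneg) auto
    finally have "(2 * \<rho>\<^sup>2 - \<rho> ^ 3) / (1 + \<rho>\<^sup>2) \<le> (2 * s\<^sup>2 - s ^ 3) / (1 + s\<^sup>2)"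
      using pos[of s] pos[of \<rho>] by (simp add: pos_divide_le_eq pos_le_divide_eq)
    then have "c * ((2 * \<rho>\<^sup>2 - \<rho> ^ 3) / (1 + \<rho>\<^sup>2)) \<le> c * ((2 * s\<^sup>2 - s ^ 3) / (1 + s\<^sup>2))"
      using c by (rule_tac mult_left_mono)
    then show ?thesis using diag[OF \<rho>(2)] by simp
  qed
qed

lemma powr_three_halves: "0 \<le> (r::real) \<Longrightarrow> r powr (3/2) = sqrt r ^ 3"
  using powr_power[of r "1/2" 3] by (cases "r = 0") (simp_all add: powr_half_sqrt)

text \<open>In the first step \<open>D\<^sub>2u\<close> is the difference quotient itself, without a mixed term, and the weight at
  level one is at most \<open>2\<close> because \<open>(2\<theta> - 1) R powr (3/2) \<le> 1 + 2\<theta> R \<le> 2 (1 + R)\<close>.\<close>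

lemma first_step_coercive:
  fixes \<theta> R \<tau> p :: real
  assumes \<theta>: "1/2 \<le> \<theta>" "\<theta> \<le> 1" and R: "0 < R" "ereal R \<le> r_s \<theta>" and pos: "0 < \<tau>" "0 \<le> p"
  shows "(2 * \<theta> - 1) * R powr (3/2) / (1 + R) * \<tau> * p \<le> 2 * \<tau> * p"
proof -
  have "(2 * \<theta> - 1) * sqrt R ^ 3 \<le> 1 + 2 * \<theta> * R"
    by (rule weight_le_below_r_s[OF \<theta>(1) R])
  also have "2 * \<theta> * R \<le> 2 * R" using \<theta> R by simp
  finally have "(2 * \<theta> - 1) * sqrt R ^ 3 \<le> 2 * (1 + R)" by simp
  then have "(2 * \<theta> - 1) * R powr (3/2) / (1 + R) \<le> 2"
    using R by (simp add: powr_three_halves pos_divide_le_eq)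
  then have "(2 * \<theta> - 1) * R powr (3/2) / (1 + R) * (\<tau> * p) \<le> 2 * (\<tau> * p)"
    using pos by (intro mult_right_mono) auto
  then show ?thesis by (simp add: mult.assoc)
qed

text \<open>In the application \<open>p = \<parallel>\<partial>\<^sub>\<tau>u\<^sup>n\<parallel>\<^sup>2\<close>, \<open>q = \<parallel>\<partial>\<^sub>\<tau>u\<^sup>n\<^sup>-\<^sup>1\<parallel>\<^sup>2\<close>, \<open>m\<close> is the mixed inner product, and \<open>r\<close>, \<open>R\<close> are the
  ratios \<open>r\<^sub>n\<close>, \<open>r\<^sub>n\<^sub>+\<^sub>1\<close>. The right-hand side is \<open>2\<tau>\<^sub>n (D\<^sub>2u\<^sup>n, \<partial>\<^sub>\<tau>u\<^sup>n)\<close> and the left-hand side is the increment of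
  the kinetic part of the energy. The mixed term has a nonpositive coefficient; the Young inequality
  with weight \<open>sqrt r\<close> splits it so that the part with \<open>q\<close> is exactly the old kinetic energy, which
  explains the exponent \<open>3/2\<close> in the energy.\<close>

lemma later_step_coercive:
  fixes \<theta> r R \<tau> \<sigma> p q m :: real
  assumes \<theta>: "1/2 \<le> \<theta>" "\<theta> \<le> 1"
    and r: "0 < r" "ereal r \<le> r_s \<theta>" and R: "0 < R" "ereal R \<le> r_s \<theta>"
    and pos: "0 < \<sigma>" "0 \<le> p" and \<tau>: "\<tau> = r * \<sigma>"
    and young: "2 * sqrt r * m \<le> q + r * p"
  shows "(2 * \<theta> - 1) * R powr (3/2) / (1 + R) * \<tau> * p - (2 * \<theta> - 1) * r powr (3/2) / (1 + r) * \<sigma> * q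
    \<le> 2 * \<tau> * ((1 + 2 * \<theta> * r) / (1 + r) * p + (1 - 2 * \<theta>) * r / (1 + r) * m)"
proof -
  define c s \<rho> where csr: "c = 2 * \<theta> - 1" "s = sqrt r" "\<rho> = sqrt R"
  have squares: "r = s\<^sup>2" "R = \<rho>\<^sup>2" and sr0: "s > 0" "\<rho> > 0" using r R by (auto simp: csr)
  have "c * s ^ 3 \<le> 1 + s\<^sup>2 + c * s\<^sup>2" "c * \<rho> ^ 3 \<le> 1 + \<rho>\<^sup>2 + c * \<rho>\<^sup>2"
    using weight_le_below_r_s[OF \<theta>(1) r] weight_le_below_r_s[OF \<theta>(1) R] sr0 unfolding csr(1) squares
    by (simp_all add: algebra_simps)
  then have "c * \<rho> ^ 3 / (1 + \<rho>\<^sup>2) \<le> 2 + c * (2 * s\<^sup>2 - s ^ 3) / (1 + s\<^sup>2)"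
    using \<theta> sr0 by (intro ratio_weight_le) (auto simp: csr(1))
  then have new: "c * \<rho> ^ 3 / (1 + \<rho>\<^sup>2) * (\<tau> * p) \<le> (2 + c * (2 * s\<^sup>2 - s ^ 3) / (1 + s\<^sup>2)) * (\<tau> * p)"
    using \<tau> pos r by (intro mult_right_mono) auto
  define K where "K = c * s ^ 3 * \<sigma> / (1 + s\<^sup>2)"
  have "0 \<le> K" using \<theta> pos sr0 by (simp add: K_def csr(1))
  moreover have "2 * s * m \<le> q + s\<^sup>2 * p" using young r by (simp add: csr)
  ultimately have cross: "K * (2 * s * m) \<le> K * q + K * (s\<^sup>2 * p)"
    unfolding distrib_left[symmetric] by (intro mult_left_mono)
  have "2 * \<tau> * ((1 + 2 * \<theta> * r) / (1 + r) * p + (1 - 2 * \<theta>) * r / (1 + r) * m)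
      = (2 + c * (2 * s\<^sup>2 - s ^ 3) / (1 + s\<^sup>2)) * (\<tau> * p) + K * (s\<^sup>2 * p) - K * (2 * s * m)"
  proof -
    have nz: "1 + s\<^sup>2 \<noteq> 0" using sr0 by (metis add_pos_pos less_irrefl zero_less_one zero_less_power)
    have th: "\<theta> = (1 + c) / 2" by (simp add: csr(1))
    show ?thesis unfolding th \<tau> squares(1) K_def using nz
      by (simp add: divide_simps) (simp add: power2_eq_square power3_eq_cube algebra_simps)
  qed
  moreover have "(2 * \<theta> - 1) * R powr (3/2) / (1 + R) * \<tau> * p - (2 * \<theta> - 1) * r powr (3/2) / (1 + r) * \<sigma> * q
      = c * \<rho> ^ 3 / (1 + \<rho>\<^sup>2) * (\<tau> * p) - K * q"
  proof -
    have "R powr (3/2) = \<rho> ^ 3" "r powr (3/2) = s ^ 3" using r R by (simp_all add: powr_three_halves csr)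
    then show ?thesis using squares by (simp add: K_def csr(1)[symmetric])
  qed
  ultimately show ?thesis using new cross by linarith
qed

section \<open>Summation by parts and the maximum argument\<close>

lemma summation_by_parts:
  fixes P :: "nat \<Rightarrow> nat \<Rightarrow> real"
  assumes "1 \<le> n"
  shows "(\<Sum>k=1..n. P k k - P k (k - 1)) = P n n - P 1 0 - (\<Sum>k=1..<n. P (Suc k) k - P k k)"
  using assms by (induction n rule: dec_induct) auto

text \<open>The estimate is applied at an index \<open>m\<close> where \<open>e\<close> is maximal, with \<open>M = e m\<close>: then \<open>e 0 \<le> e m\<close>
  gives \<open>(e m)\<^sup>2 \<le> (e 0 + K) (e m)\<close>, which can be divided by \<open>e m\<close>.\<close>

lemma maximum_bound:
  fixes e :: "nat \<Rightarrow> real"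
  assumes nonneg: "\<And>k. k \<le> n \<Longrightarrow> 0 \<le> e k" and K: "0 \<le> K"
    and bound: "\<And>m M. 1 \<le> m \<Longrightarrow> m \<le> n \<Longrightarrow> (\<And>k. k \<le> m \<Longrightarrow> e k \<le> M) \<Longrightarrow> (e m)\<^sup>2 \<le> (e 0)\<^sup>2 + K * M"
  shows "e n \<le> e 0 + K"
proof -
  have "Max (e ` {..n}) \<in> e ` {..n}" by (intro Max_in) auto
  then obtain m where m: "m \<le> n" and Max: "Max (e ` {..n}) = e m" by blast
  have max: "e k \<le> e m" if "k \<le> n" for k
    unfolding Max[symmetric] using that by (intro Max_ge) auto
  have "e m \<le> e 0 + K"
  proof (cases "m = 0 \<or> e m = 0")
    case True
    then show ?thesis using nonneg[of 0] K by auto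
  next
    case False
    then have em: "e m > 0" using nonneg[of m] m by auto
    have "(e m)\<^sup>2 \<le> (e 0)\<^sup>2 + K * e m" using False m max by (intro bound) auto
    also have "\<dots> \<le> e 0 * e m + K * e m"
      using max[of 0] nonneg[of 0] by (simp add: power2_eq_square mult_left_mono)
    finally have "e m * e m \<le> (e 0 + K) * e m" by (simp add: power2_eq_square algebra_simps)
    then show ?thesis using em by simp
  qed
  then show ?thesis using max[of n] by simp
qed

section \<open>Energy dissipation over one step\<close>

lemma L2_diff: "f \<in> L2 \<Omega> \<Longrightarrow> g \<in> L2 \<Omega> \<Longrightarrow> (\<lambda>x. f x - g x) \<in> L2 \<Omega>"
  using L2_lincomb[of f \<Omega> g 1 "-1"] by simp

lemma L2_inner_diff_left:
  assumes "f \<in> L2 \<Omega>" "g \<in> L2 \<Omega>" "h \<in> L2 \<Omega>"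
  shows "L2_inner \<Omega> (\<lambda>x. f x - g x) h = L2_inner \<Omega> f h - L2_inner \<Omega> g h"
  using L2_inner_lincomb_left[OF assms, of 1 "-1"] by simp

lemma theta_mean_in_L2:
  "g k \<in> L2 \<Omega> \<Longrightarrow> g (k - 1) \<in> L2 \<Omega> \<Longrightarrow> (\<lambda>x. theta_mean \<theta> (\<lambda>m. g m x) k) \<in> L2 \<Omega>"
  unfolding theta_mean_def by (rule L2_lincomb)

text \<open>The gap between the two sides is \<open>(2\<theta> - 1)\<close> times the squared norm of \<open>v k - v (k - 1)\<close>.\<close>

lemma theta_mean_gradient_coercive:
  assumes L2: "v k \<in> L2 \<Omega>" "v (k - 1) \<in> L2 \<Omega>" and \<theta>: "1/2 \<le> \<theta>" and \<tau>: "0 < \<tau>"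
  shows "(L2_norm \<Omega> (v k))\<^sup>2 - (L2_norm \<Omega> (v (k - 1)))\<^sup>2
    \<le> 2 * \<tau> * L2_inner \<Omega> (\<lambda>x. theta_mean \<theta> (\<lambda>m. v m x) k)
                       (\<lambda>x. (1/\<tau>) *\<^sub>R v k x + (-1/\<tau>) *\<^sub>R v (k - 1) x)"
proof -
  let ?p = "L2_inner \<Omega> (v k) (v k)" and ?q = "L2_inner \<Omega> (v (k - 1)) (v (k - 1))"
    and ?m = "L2_inner \<Omega> (v k) (v (k - 1))"
  have "0 \<le> (L2_norm \<Omega> (\<lambda>x. 1 *\<^sub>R v k x + (-1) *\<^sub>R v (k - 1) x))\<^sup>2" by simp
  then have "0 \<le> ?p - 2 * ?m + ?q"
    unfolding L2_norm_squared_lincomb[OF L2] by (simp add: L2_norm_squared)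
  then have "0 \<le> (2 * \<theta> - 1) * (?p - 2 * ?m + ?q)" using \<theta> by simp
  moreover have "2 * \<tau> * L2_inner \<Omega> (\<lambda>x. theta_mean \<theta> (\<lambda>m. v m x) k)
      (\<lambda>x. (1/\<tau>) *\<^sub>R v k x + (-1/\<tau>) *\<^sub>R v (k - 1) x)
      = 2 * (\<theta> * ?p - (1 - \<theta>) * ?q + (1 - 2 * \<theta>) * ?m)"
    using \<tau>
    unfolding theta_mean_def L2_inner_lincomb_left[OF L2 L2_lincomb[OF L2]]
      L2_inner_lincomb_right[OF L2 L2(1)] L2_inner_lincomb_right[OF L2 L2(2)]
      L2_inner_commute[of \<Omega> "v (k - 1)" "v k"]
    by (simp add: field_simps)
  ultimately show ?thesis by (simp add: L2_norm_squared algebra_simps)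
qed

text \<open>The scheme is tested with \<open>\<partial>\<^sub>\<tau>u\<^sup>k\<close> and multiplied by \<open>2\<tau>\<^sub>k\<close>.\<close>

lemma energy_increment_le:
  fixes \<Omega> :: "'a::euclidean_space set"
  assumes \<Omega>: "open \<Omega>" "bounded \<Omega>"
    and grid: "\<And>k. k \<in> {1..N} \<Longrightarrow> t (k - 1) < t k"
    and \<theta>: "1/2 \<le> \<theta>" "\<theta> \<le> 1"
    and ratios: "\<And>k. k \<in> {2..N} \<Longrightarrow> r k = step t k / step t (k - 1)"
    and ratio_bound: "\<And>k. k \<in> {2..N+1} \<Longrightarrow> 0 < r k \<and> ereal (r k) \<le> r_s \<theta>"
    and scheme: "WSBDF2_solution \<Omega> \<theta> N t r f u Du"
    and k: "k \<in> {1..N}"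
  shows "energy \<Omega> \<theta> t r u Du k - energy \<Omega> \<theta> t r u Du (k - 1)
    \<le> 2 * step t k * L2_inner \<Omega> (\<lambda>x. theta_mean \<theta> (\<lambda>m. f (t m) x) k) (\<lambda>x. dquot t (\<lambda>m. u m x) k)"
proof -
  \<comment> \<open>\<open>W\<close> is \<open>\<partial>\<^sub>\<tau>u\<close>, and \<open>DW\<close> is a weak gradient of it at level \<open>k\<close>.\<close>
  define W where "W = (\<lambda>j x. dquot t (\<lambda>m. u m x) j)"
  define \<tau> where "\<tau> = step t k"
  define DW where "DW = (\<lambda>x. (1/\<tau>) *\<^sub>R Du k x + (-1/\<tau>) *\<^sub>R Du (k - 1) x)"
  have \<tau>: "\<tau> > 0" using grid[OF k] by (simp add: \<tau>_def step_def)
  have u: "u j \<in> H01 \<Omega>" "has_weak_gradient \<Omega> (u j) (Du j)" if "j \<le> N" for j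
    using scheme that unfolding WSBDF2_solution_def by auto
  have W_eq: "W j = (\<lambda>x. (1 / step t j) *\<^sub>R u j x + (-1 / step t j) *\<^sub>R u (j - 1) x)" for j
    by (simp add: W_def dquot_def bdiff_def diff_divide_distrib)
  have W_L2: "W j \<in> L2 \<Omega>" if "j \<le> N" for j
    unfolding W_eq using that by (intro L2_lincomb has_weak_gradient_in_L2(1)[OF u(2)]) auto
  have Du_L2: "Du j \<in> L2 \<Omega>" if "j \<le> N" for j
    using has_weak_gradient_in_L2[OF u(2)[OF that]] by simp
  have W_H01: "W k \<in> H01 \<Omega>"
    unfolding W_eq using k by (intro H01_lincomb \<Omega> u(1)) auto
  have W_grad: "has_weak_gradient \<Omega> (W k) DW"
    unfolding W_eq DW_def \<tau>_def using k by (intro has_weak_gradient_lincomb \<Omega> u(2)) auto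
  have tested: "L2_inner \<Omega> (\<lambda>x. D2 \<theta> t r (\<lambda>m. u m x) k) (W k)
      + L2_inner \<Omega> (\<lambda>x. theta_mean \<theta> (\<lambda>m. Du m x) k) DW
      = L2_inner \<Omega> (\<lambda>x. theta_mean \<theta> (\<lambda>m. f (t m) x) k) (W k)"
    using scheme k W_H01 W_grad unfolding WSBDF2_solution_def by blast
  have gradient: "(L2_norm \<Omega> (Du k))\<^sup>2 - (L2_norm \<Omega> (Du (k - 1)))\<^sup>2
      \<le> 2 * \<tau> * L2_inner \<Omega> (\<lambda>x. theta_mean \<theta> (\<lambda>m. Du m x) k) DW"
    unfolding DW_def using k by (intro theta_mean_gradient_coercive Du_L2 \<theta> \<tau>) auto
  have R: "0 < r (k + 1)" "ereal (r (k + 1)) \<le> r_s \<theta>" using ratio_bound[of "k + 1"] k by auto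
  have kinetic: "energy \<Omega> \<theta> t r u Du k - energy \<Omega> \<theta> t r u Du (k - 1)
      \<le> 2 * \<tau> * L2_inner \<Omega> (\<lambda>x. D2 \<theta> t r (\<lambda>m. u m x) k) (W k)
        + ((L2_norm \<Omega> (Du k))\<^sup>2 - (L2_norm \<Omega> (Du (k - 1)))\<^sup>2)"
  proof (cases "k = 1")
    case True
    have "(\<lambda>x. D2 \<theta> t r (\<lambda>m. u m x) k) = W k"
      by (simp add: True D2_def W_def dquot_def)
    then show ?thesis
      using first_step_coercive[OF \<theta> R \<tau>, of "(L2_norm \<Omega> (W k))\<^sup>2"]
      by (simp add: energy_def True L2_norm_squared[symmetric] W_def \<tau>_def)
  next
    case False
    then have k2: "k \<in> {2..N}" using k by auto
    \<comment> \<open>In terms of \<open>W\<close> the factor \<open>r\<^sup>2\<close> of the second difference turns into \<open>r\<close>, since \<open>\<tau> = r \<sigma>\<close>.\<close>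
    define \<sigma> where "\<sigma> = step t (k - 1)"
    have "k - 1 \<in> {1..N}" using k2 by auto
    then have \<sigma>: "\<sigma> > 0" using grid[of "k - 1"] by (simp add: \<sigma>_def step_def)
    have r: "0 < r k" "ereal (r k) \<le> r_s \<theta>" using ratio_bound[of k] k2 by auto
    have \<tau>\<sigma>: "\<tau> = r k * \<sigma>" using ratios[OF k2] \<sigma> by (simp add: \<tau>_def \<sigma>_def)
    have D2: "(\<lambda>x. D2 \<theta> t r (\<lambda>m. u m x) k)
        = (\<lambda>x. ((1 + 2 * \<theta> * r k) / (1 + r k)) *\<^sub>R W k x + ((1 - 2 * \<theta>) * r k / (1 + r k)) *\<^sub>R W (k - 1) x)"
    proof
      fix x
      have bd: "bdiff (\<lambda>m. u m x) k = \<tau> * W k x" "bdiff (\<lambda>m. u m x) (k - 1) = \<sigma> * W (k - 1) x"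
        using \<tau> \<sigma> by (simp_all add: W_def dquot_def \<tau>_def \<sigma>_def)
      have "1 + r k \<noteq> 0" using r by simp
      then show "D2 \<theta> t r (\<lambda>m. u m x) k
        = ((1 + 2 * \<theta> * r k) / (1 + r k)) *\<^sub>R W k x + ((1 - 2 * \<theta>) * r k / (1 + r k)) *\<^sub>R W (k - 1) x"
        using False r \<sigma> unfolding D2_def bd \<tau>_def[symmetric] unfolding \<tau>\<sigma>
        by (simp add: power2_eq_square)
    qed
    have kL2: "W k \<in> L2 \<Omega>" "W (k - 1) \<in> L2 \<Omega>" using k by (auto intro: W_L2)
    let ?p = "(L2_norm \<Omega> (W k))\<^sup>2" and ?q = "(L2_norm \<Omega> (W (k - 1)))\<^sup>2"
      and ?m = "L2_inner \<Omega> (W (k - 1)) (W k)"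
    \<comment> \<open>The Young inequality for the mixed term, with the weight that reproduces the old energy.\<close>
    have "0 \<le> (L2_norm \<Omega> (\<lambda>x. 1 *\<^sub>R W (k - 1) x + (- sqrt (r k)) *\<^sub>R W k x))\<^sup>2" by simp
    then have young: "2 * sqrt (r k) * ?m \<le> ?q + r k * ?p"
      unfolding L2_norm_squared_lincomb[OF kL2(2,1)] using r by simp
    have "L2_inner \<Omega> (\<lambda>x. D2 \<theta> t r (\<lambda>m. u m x) k) (W k)
        = (1 + 2 * \<theta> * r k) / (1 + r k) * ?p + (1 - 2 * \<theta>) * r k / (1 + r k) * ?m"
      unfolding D2 L2_inner_lincomb_left[OF kL2 kL2(1)] L2_norm_squared ..
    with later_step_coercive[OF \<theta> r R \<sigma> _ \<tau>\<sigma> young] False k2 show ?thesis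
      by (simp add: energy_def W_def \<tau>_def \<sigma>_def)
  qed
  show ?thesis
    using kinetic gradient tested[symmetric] by (simp add: W_def \<tau>_def distrib_left)
qed

lemma gradient_le_energy:
  assumes "1/2 \<le> \<theta>" "k \<noteq> 0 \<Longrightarrow> 0 < r (k + 1) \<and> t (k - 1) < t k"
  shows "(L2_norm \<Omega> (Du k))\<^sup>2 \<le> energy \<Omega> \<theta> t r u Du k"
  using assms by (cases "k = 0") (auto simp: energy_def step_def)

section \<open>The source term\<close>

text \<open>Each jump of the means is \<open>\<theta> d\<^sub>k\<^sub>+\<^sub>1 + (1 - \<theta>) d\<^sub>k\<close> with \<open>d\<^sub>k\<close> the jump of \<open>g\<close>, and the first mean is
  \<open>g 0 + \<theta> d\<^sub>1\<close>. Summed up, every \<open>d\<^sub>k\<close> has total weight one except the last, whose weight is only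
  \<open>\<theta>\<close>; the subtracted term records this, so that the next jump can supply the missing \<open>1 - \<theta>\<close>.\<close>

lemma theta_mean_total_variation:
  fixes g :: "nat \<Rightarrow> 'a::euclidean_space \<Rightarrow> real"
  defines "F \<equiv> \<lambda>\<theta> k x. theta_mean \<theta> (\<lambda>m. g m x) k"
  assumes \<theta>: "0 \<le> \<theta>" "\<theta> \<le> 1" and "1 \<le> m" and "\<And>k. k \<le> m \<Longrightarrow> g k \<in> L2 \<Omega>"
  shows "L2_norm \<Omega> (F \<theta> 1) + (\<Sum>k=1..<m. L2_norm \<Omega> (\<lambda>x. F \<theta> (Suc k) x - F \<theta> k x))
    \<le> L2_norm \<Omega> (g 0) + (\<Sum>k=1..m. L2_norm \<Omega> (\<lambda>x. bdiff (\<lambda>m. g m x) k))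
       - (1 - \<theta>) * L2_norm \<Omega> (\<lambda>x. bdiff (\<lambda>m. g m x) m)"
  using assms(4,5)
proof (induction m rule: dec_induct)
  case base
  have d: "(\<lambda>x. bdiff (\<lambda>m. g m x) 1) \<in> L2 \<Omega>"
    unfolding bdiff_def by (intro L2_diff base) auto
  have "F \<theta> 1 = (\<lambda>x. 1 *\<^sub>R g 0 x + \<theta> *\<^sub>R bdiff (\<lambda>m. g m x) 1)"
    by (simp add: F_def theta_mean_def bdiff_def algebra_simps)
  then show ?case
    using L2_norm_lincomb_le[OF base[of 0] d, of 1 \<theta>] \<theta> by (simp add: algebra_simps)
next
  case (step m)
  have d: "(\<lambda>x. bdiff (\<lambda>m. g m x) k) \<in> L2 \<Omega>" if "k \<le> Suc m" for k
    unfolding bdiff_def using that by (intro L2_diff step.prems) auto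
  have "(\<lambda>x. F \<theta> (Suc m) x - F \<theta> m x)
      = (\<lambda>x. \<theta> *\<^sub>R bdiff (\<lambda>m. g m x) (Suc m) + (1 - \<theta>) *\<^sub>R bdiff (\<lambda>m. g m x) m)"
    by (simp add: F_def theta_mean_def bdiff_def algebra_simps)
  then have "L2_norm \<Omega> (\<lambda>x. F \<theta> (Suc m) x - F \<theta> m x)
      \<le> \<theta> * L2_norm \<Omega> (\<lambda>x. bdiff (\<lambda>m. g m x) (Suc m)) + (1 - \<theta>) * L2_norm \<Omega> (\<lambda>x. bdiff (\<lambda>m. g m x) m)"
    using L2_norm_lincomb_le[OF d[of "Suc m"] d[of m], of \<theta> "1 - \<theta>"] \<theta> by simp
  moreover have "L2_norm \<Omega> (F \<theta> 1) + (\<Sum>k=1..<m. L2_norm \<Omega> (\<lambda>x. F \<theta> (Suc k) x - F \<theta> k x))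
    \<le> L2_norm \<Omega> (g 0) + (\<Sum>k=1..m. L2_norm \<Omega> (\<lambda>x. bdiff (\<lambda>m. g m x) k))
       - (1 - \<theta>) * L2_norm \<Omega> (\<lambda>x. bdiff (\<lambda>m. g m x) m)"
    using step by simp
  ultimately show ?case using step.hyps by (simp add: algebra_simps)
qed

lemma L2_norm_le_total_variation:
  assumes "1 \<le> m" "\<And>k. 1 \<le> k \<Longrightarrow> k \<le> m \<Longrightarrow> F k \<in> L2 \<Omega>"
  shows "L2_norm \<Omega> (F m) \<le> L2_norm \<Omega> (F 1) + (\<Sum>k=1..<m. L2_norm \<Omega> (\<lambda>x. F (Suc k) x - F k x))"
  using assms
proof (induction m rule: dec_induct)
  case (step m)
  have F: "F m \<in> L2 \<Omega>" "F (Suc m) \<in> L2 \<Omega>" using step.hyps step.prems by auto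
  have "L2_norm \<Omega> (F (Suc m)) \<le> L2_norm \<Omega> (F m) + L2_norm \<Omega> (\<lambda>x. F (Suc m) x - F m x)"
    using L2_norm_lincomb_le[OF F(1) L2_diff[OF F(2,1)], of 1 1] by simp
  with step show ?case by simp
qed simp

text \<open>Moving the differences from \<open>u\<close> to \<open>F\<close> leaves only values of \<open>u\<close>, which are bounded by \<open>B\<close>. The
  boundary term at \<open>m\<close> costs at most \<open>V\<close>, and the one at the start together with the jumps
  another \<open>V\<close>.\<close>

lemma duality_sum_bound:
  assumes m: "1 \<le> m" and F: "\<And>k. 1 \<le> k \<Longrightarrow> k \<le> m \<Longrightarrow> F k \<in> L2 \<Omega>"
    and u: "\<And>k. k \<le> m \<Longrightarrow> u k \<in> L2 \<Omega>" "\<And>k. k \<le> m \<Longrightarrow> L2_norm \<Omega> (u k) \<le> B"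
    and V: "L2_norm \<Omega> (F 1) + (\<Sum>k=1..<m. L2_norm \<Omega> (\<lambda>x. F (Suc k) x - F k x)) \<le> V"
  shows "(\<Sum>k=1..m. L2_inner \<Omega> (F k) (u k) - L2_inner \<Omega> (F k) (u (k - 1))) \<le> 2 * V * B"
proof -
  have B: "0 \<le> B" using u(2)[of 0] L2_norm_nonneg[of \<Omega> "u 0"] by simp
  have pair: "\<bar>L2_inner \<Omega> h (u k)\<bar> \<le> L2_norm \<Omega> h * B" if "h \<in> L2 \<Omega>" "k \<le> m" for h k
    using L2_Cauchy_Schwarz[OF that(1) u(1)[OF that(2)]] mult_left_mono[OF u(2)[OF that(2)] L2_norm_nonneg]
    by (rule order_trans)
  have jump: "- (L2_inner \<Omega> (F (Suc k)) (u k) - L2_inner \<Omega> (F k) (u k))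
      \<le> L2_norm \<Omega> (\<lambda>x. F (Suc k) x - F k x) * B" if k: "k \<in> {1..<m}" for k
  proof -
    have FF: "F (Suc k) \<in> L2 \<Omega>" "F k \<in> L2 \<Omega>" using k by (auto intro: F)
    show ?thesis
      using pair[OF L2_diff[OF FF], of k] k L2_inner_diff_left[OF FF u(1), of k] by auto
  qed
  let ?S = "\<Sum>k=1..<m. L2_norm \<Omega> (\<lambda>x. F (Suc k) x - F k x)"
  have "(\<Sum>k=1..m. L2_inner \<Omega> (F k) (u k) - L2_inner \<Omega> (F k) (u (k - 1)))
      = L2_inner \<Omega> (F m) (u m) - L2_inner \<Omega> (F 1) (u 0)
        + (\<Sum>k=1..<m. - (L2_inner \<Omega> (F (Suc k)) (u k) - L2_inner \<Omega> (F k) (u k)))"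
    unfolding sum_negf by (subst summation_by_parts[OF m]) simp
  also have "\<dots> \<le> L2_norm \<Omega> (F m) * B + L2_norm \<Omega> (F 1) * B + ?S * B"
  proof -
    have "(\<Sum>k=1..<m. - (L2_inner \<Omega> (F (Suc k)) (u k) - L2_inner \<Omega> (F k) (u k))) \<le> ?S * B"
      unfolding sum_distrib_right by (intro sum_mono jump)
    moreover have "\<bar>L2_inner \<Omega> (F m) (u m)\<bar> \<le> L2_norm \<Omega> (F m) * B"
      "\<bar>L2_inner \<Omega> (F 1) (u 0)\<bar> \<le> L2_norm \<Omega> (F 1) * B"
      using m by (auto intro!: pair F)
    ultimately show ?thesis by linarith
  qed
  also have "\<dots> = (L2_norm \<Omega> (F m) + (L2_norm \<Omega> (F 1) + ?S)) * B" by (simp add: algebra_simps)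
  also have "\<dots> \<le> (V + V) * B"
  proof -
    have "L2_norm \<Omega> (F m) \<le> L2_norm \<Omega> (F 1) + ?S"
      using m F by (rule L2_norm_le_total_variation)
    with V show ?thesis using B by (intro mult_right_mono add_mono) auto
  qed
  finally show ?thesis by (simp add: mult.assoc)
qed

section \<open>Dissipation and stability of the scheme\<close>

theorem theorem3p1:
  fixes \<Omega> :: "'a::euclidean_space set"
    and C \<theta> T :: real
    and N :: nat
    and t r :: "nat \<Rightarrow> real"
    and f :: "real \<Rightarrow> 'a \<Rightarrow> real"
    and u :: "nat \<Rightarrow> 'a \<Rightarrow> real"
    and Du :: "nat \<Rightarrow> 'a \<Rightarrow> 'a"
  assumes domain: "open \<Omega>" "connected \<Omega>" "bounded \<Omega>" "\<Omega> \<noteq> {}"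
    and poincare: "poincare_constant \<Omega> C"
    and grid: "N \<ge> 1" "t 0 = 0" "t N = T" "\<And>k. k \<in> {1..N} \<Longrightarrow> t (k - 1) < t k"
    and theta: "1/2 \<le> \<theta>" "\<theta> \<le> 1"
    and ratios: "\<And>k. k \<in> {2..N} \<Longrightarrow> r k = step t k / step t (k - 1)"
    and ratio_bound: "\<And>k. k \<in> {2..N+1} \<Longrightarrow> 0 < r k \<and> ereal (r k) \<le> r_s \<theta>"
    and data: "\<And>n. n \<le> N \<Longrightarrow> f (t n) \<in> L2 \<Omega>"
    and scheme: "WSBDF2_solution \<Omega> \<theta> N t r f u Du"
  shows "(\<forall>k\<in>{1..N}. dquot t (energy \<Omega> \<theta> t r u Du) k
            \<le> 2 * L2_inner \<Omega> (\<lambda>x. theta_mean \<theta> (\<lambda>m. f (t m) x) k)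
                             (\<lambda>x. dquot t (\<lambda>m. u m x) k))
       \<and> (\<forall>n\<in>{1..N}. sqrt (energy \<Omega> \<theta> t r u Du n)
            \<le> sqrt (energy \<Omega> \<theta> t r u Du 0)
              + 4 * C * (L2_norm \<Omega> (f (t 0))
                  + (\<Sum>k=1..n. L2_norm \<Omega> (\<lambda>x. bdiff (\<lambda>m. f (t m) x) k))))"
proof -
  define \<E> where "\<E> = energy \<Omega> \<theta> t r u Du"
  define F where "F = (\<lambda>k x. theta_mean \<theta> (\<lambda>m. f (t m) x) k)"
  have \<tau>: "step t k > 0" if "k \<in> {1..N}" for k
    using grid(4)[OF that] by (simp add: step_def)
  have increment: "\<E> k - \<E> (k - 1) \<le> 2 * step t k * L2_inner \<Omega> (F k) (\<lambda>x. dquot t (\<lambda>m. u m x) k)"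
    if "k \<in> {1..N}" for k
    unfolding \<E>_def F_def
    by (rule energy_increment_le[OF domain(1,3) grid(4) theta ratios ratio_bound scheme that])
  have dissipation: "dquot t \<E> k \<le> 2 * L2_inner \<Omega> (F k) (\<lambda>x. dquot t (\<lambda>m. u m x) k)"
    if "k \<in> {1..N}" for k
    using increment[OF that] \<tau>[OF that]
    by (simp add: dquot_def[of t \<E>] bdiff_def[of \<E>] pos_divide_le_eq mult_ac)

  have u: "u k \<in> H01 \<Omega>" "has_weak_gradient \<Omega> (u k) (Du k)" if "k \<le> N" for k
    using scheme that unfolding WSBDF2_solution_def by auto
  note u_L2 = has_weak_gradient_in_L2(1)[OF u(2)]
  have F_L2: "F k \<in> L2 \<Omega>" if "k \<le> N" for k
    unfolding F_def using that by (intro theta_mean_in_L2 data) auto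
  have Du_le: "(L2_norm \<Omega> (Du k))\<^sup>2 \<le> \<E> k" if "k \<le> N" for k
    unfolding \<E>_def using that ratio_bound[of "k + 1"] grid(4)[of k] theta
    by (intro gradient_le_energy) auto
  then have \<E>_nonneg: "0 \<le> \<E> k" if "k \<le> N" for k
    using that zero_le_power2 order_trans by blast
  have C: "C > 0" using poincare by (simp add: poincare_constant_def)
  have u_le: "L2_norm \<Omega> (u k) \<le> C * sqrt (\<E> k)" if "k \<le> N" for k
  proof -
    have "L2_norm \<Omega> (u k) \<le> C * L2_norm \<Omega> (Du k)"
      using poincare u[OF that] unfolding poincare_constant_def by blast
    also have "\<dots> \<le> C * sqrt (\<E> k)"
      using C Du_le[OF that] by (intro mult_left_mono real_le_rsqrt) auto
    finally show ?thesis .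
  qed

  define V where "V = (\<lambda>m. L2_norm \<Omega> (f (t 0)) + (\<Sum>k=1..m. L2_norm \<Omega> (\<lambda>x. bdiff (\<lambda>m. f (t m) x) k)))"
  have V_nonneg: "0 \<le> V m" for m
    unfolding V_def by (intro add_nonneg_nonneg sum_nonneg L2_norm_nonneg)
  have V_mono: "V m \<le> V n" if "m \<le> n" for m n
    unfolding V_def using that by (intro add_left_mono sum_mono2) (auto simp: L2_norm_nonneg)
  \<comment> \<open>The increments are summed up to \<open>m\<close>; by the Poincare inequality \<open>C * M\<close> bounds the norms of \<open>u\<close>.\<close>
  have energy_bound: "\<E> m \<le> \<E> 0 + 4 * C * V m * M"
    if m: "1 \<le> m" "m \<le> N" and M: "\<And>k. k \<le> m \<Longrightarrow> sqrt (\<E> k) \<le> M" for m M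
  proof -
    have "L2_norm \<Omega> (F 1) + (\<Sum>k=1..<m. L2_norm \<Omega> (\<lambda>x. F (Suc k) x - F k x))
        \<le> V m - (1 - \<theta>) * L2_norm \<Omega> (\<lambda>x. bdiff (\<lambda>m. f (t m) x) m)"
      unfolding V_def F_def using m theta data by (intro theta_mean_total_variation) auto
    also have "\<dots> \<le> V m" using theta by (simp add: L2_norm_nonneg)
    finally have tv: "L2_norm \<Omega> (F 1) + (\<Sum>k=1..<m. L2_norm \<Omega> (\<lambda>x. F (Suc k) x - F k x)) \<le> V m" .
    have u_M: "L2_norm \<Omega> (u k) \<le> C * M" if "k \<le> m" for k
      using u_le[of k] mult_left_mono[OF M[OF that], of C] that m C by linarith
    have "\<E> m - \<E> 0 = (\<Sum>k=1..m. \<E> k - \<E> (k - 1))"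
      using m(1) by (induction m rule: dec_induct) auto
    also have "\<dots> \<le> (\<Sum>k=1..m. 2 * (L2_inner \<Omega> (F k) (u k) - L2_inner \<Omega> (F k) (u (k - 1))))"
    proof (rule sum_mono)
      fix k assume k: "k \<in> {1..m}"
      then have kN: "k \<in> {1..N}" using m by auto
      have "(\<lambda>x. dquot t (\<lambda>m. u m x) k) = (\<lambda>x. (1 / step t k) *\<^sub>R u k x + (-1 / step t k) *\<^sub>R u (k - 1) x)"
        by (simp add: dquot_def bdiff_def diff_divide_distrib)
      moreover have "L2_inner \<Omega> (F k) (\<lambda>x. (1 / step t k) *\<^sub>R u k x + (-1 / step t k) *\<^sub>R u (k - 1) x)
        = (1 / step t k) * L2_inner \<Omega> (F k) (u k) + (-1 / step t k) * L2_inner \<Omega> (F k) (u (k - 1))"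
        using kN by (intro L2_inner_lincomb_right u_L2 F_L2) auto
      ultimately show "\<E> k - \<E> (k - 1) \<le> 2 * (L2_inner \<Omega> (F k) (u k) - L2_inner \<Omega> (F k) (u (k - 1)))"
        using increment[OF kN] \<tau>[OF kN] by (simp add: field_simps)
    qed
    also have "\<dots> = 2 * (\<Sum>k=1..m. L2_inner \<Omega> (F k) (u k) - L2_inner \<Omega> (F k) (u (k - 1)))"
      by (simp add: sum_distrib_left)
    also have "\<dots> \<le> 2 * (2 * V m * (C * M))"
      using m by (intro mult_left_mono duality_sum_bound[OF m(1) _ _ _ tv]) (auto intro: F_L2 u_L2 u_M)
    finally show ?thesis by (simp add: mult_ac)
  qed

  have stability: "sqrt (\<E> n) \<le> sqrt (\<E> 0) + 4 * C * V n" if n: "n \<in> {1..N}" for n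
  proof (rule maximum_bound)
    show "0 \<le> sqrt (\<E> k)" if "k \<le> n" for k using \<E>_nonneg[of k] that n by simp
    show "0 \<le> 4 * C * V n" using C V_nonneg[of n] by simp
    fix m M assume m: "1 \<le> m" "m \<le> n" and M: "\<And>k. k \<le> m \<Longrightarrow> sqrt (\<E> k) \<le> M"
    have "0 \<le> M" using M[of 0] \<E>_nonneg[of 0] real_sqrt_ge_zero order_trans by blast
    then have "4 * C * V m * M \<le> 4 * C * V n * M"
      using C V_mono[OF m(2)] by (intro mult_right_mono mult_left_mono) auto
    then show "(sqrt (\<E> m))\<^sup>2 \<le> (sqrt (\<E> 0))\<^sup>2 + 4 * C * V n * M"
      using energy_bound[OF m(1) _ M] m n \<E>_nonneg[of m] \<E>_nonneg[of 0] by auto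
  qed
  show ?thesis
    using dissipation stability unfolding \<E>_def F_def V_def by blast
qed

end
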